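(* Let $m\geq 14$ be an integer. Then \[ \gamma_m\geq \begin{cases} 3m-12 &\text{if }m\not\equiv 2\pmod{3},\\ 2m-9&\text{if }m\equiv 2\pmod{3}. \end{cases} \]
   Context: $\mathbb{N}$ denotes the positive integers. For an integer $m\ge 3$ and $x\in\mathbb{Z}$, set $P_m(x):=\frac{(m-2)x^2-(m-4)x}{2}$. For $\ell\in\mathbb{N}$, $\boldsymbol{a}=(a_1,\dots,a_\ell)\in\mathbb{N}^{\ell}$ and $\boldsymbol{x}\in\mathbb{Z}^\ell$ set $P_{m,\boldsymbol{a}}(\boldsymbol{x}):=\sum_{j=1}^{\ell} a_j P_m(x_j)$. The form $P_{m,\boldsymbol{a}}$ represents $n$ if $P_{m,\boldsymbol{a}}(\boldsymbol{x})=n$ for some $\boldsymbol{x}\in\mathbb{Z}^\ell$, and it is universal if it represents every $n\in\mathbb{N}$. $\gamma_m$ denotes the minimal element of $\mathbb{N}$ with the property that, for every $\ell\in\mathbb{N}$ and every $\boldsymbol{a}\in\mathbb{N}^\ell$, $P_{m,\boldsymbol{a}}$ is universal if and only if it represents every positive integer $n\le\gamma_m$. (Such a $\gamma_m$ is known to exist.) *)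

theory Defs
  imports "HOL-Library.Extended_Nat" "HOL-Number_Theory.Cong"
begin

text \<open>
  The division is exact: see \<open>two_times_polygonal\<close>. The argument \<open>m\<close> is cast to \<open>int\<close> before
  subtracting, so nothing is truncated.
\<close>

definition polygonal :: "nat \<Rightarrow> int \<Rightarrow> int" where
  "polygonal m x = ((int m - 2) * x\<^sup>2 - (int m - 4) * x) div 2"

lemma two_times_polygonal: "2 * polygonal m x = (int m - 2) * x\<^sup>2 - (int m - 4) * x"
proof -
  have "even ((int m - 2) * x\<^sup>2 - (int m - 4) * x)"
    by simp
  then show ?thesis
    unfolding polygonal_def by simp
qed

text \<open>
  Tuples of length \<open>\<ell>\<close> are lists; \<open>a\<close> in \<open>\<nat>\<^sup>\<ell>\<close> with \<open>\<ell> \<ge> 1\<close> and positive entries is a list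
  satisfying \<open>coeff_tuple\<close>.
\<close>

definition coeff_tuple :: "nat list \<Rightarrow> bool" where
  "coeff_tuple a \<longleftrightarrow> a \<noteq> [] \<and> (\<forall>c\<in>set a. 0 < c)"

definition polygonal_form :: "nat \<Rightarrow> nat list \<Rightarrow> int list \<Rightarrow> int" where
  "polygonal_form m a x = (\<Sum>j<length a. int (a ! j) * polygonal m (x ! j))"

definition represents :: "nat \<Rightarrow> nat list \<Rightarrow> nat \<Rightarrow> bool" where
  "represents m a n \<longleftrightarrow> (\<exists>x. length x = length a \<and> polygonal_form m a x = int n)"

definition universal :: "nat \<Rightarrow> nat list \<Rightarrow> bool" where
  "universal m a \<longleftrightarrow> (\<forall>n\<ge>1. represents m a n)"

definition universality_bound :: "nat \<Rightarrow> nat \<Rightarrow> bool" where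
  "universality_bound m g \<longleftrightarrow>
     g \<ge> 1 \<and> (\<forall>a. coeff_tuple a \<longrightarrow> (universal m a \<longleftrightarrow> (\<forall>n. 1 \<le> n \<and> n \<le> g \<longrightarrow> represents m a n)))"

text \<open>
  The minimal \<open>g\<close> with \<open>universality_bound m g\<close>. That such a \<open>g\<close> exists is a known theorem, not proved
  here; taking the infimum in \<open>enat\<close> lets \<open>gamma\<close> be defined without it (the infimum of
  the empty set is \<open>\<infinity>\<close>, not an arbitrary number). Whenever some bound exists, \<open>gamma m\<close> is the least
  one: see \<open>gamma_eq_Least\<close>.
\<close>

definition gamma :: "nat \<Rightarrow> enat" where
  "gamma m = (INF g\<in>{g. universality_bound m g}. enat g)"

lemma gamma_eq_Least:
  assumes "\<exists>g. universality_bound m g"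
  shows "gamma m = enat (LEAST g. universality_bound m g)"
  unfolding gamma_def
proof (rule antisym)
  show "(INF g\<in>{g. universality_bound m g}. enat g) \<le> enat (LEAST g. universality_bound m g)"
    using assms by (intro INF_lower) (auto intro: LeastI_ex)
  show "enat (LEAST g. universality_bound m g) \<le> (INF g\<in>{g. universality_bound m g}. enat g)"
    by (intro INF_greatest) (auto intro: Least_le)
qed

end

theory Submission
  imports Defs
begin

text \<open>
  The witness is the form with coefficients \<open>(1, 1, 3, \<dots>, 3)\<close>, with \<open>k\<close> threes. Taking all
  variables in \<open>{0, 1}\<close> gives every \<open>n \<le> 3k + 2\<close>. Conversely, \<open>P\<^sub>m\<close> takes only the values
  \<open>0, 1, m - 3, m\<close> below \<open>3m - 8\<close>, so for a target \<open>n < 3m - 9\<close> the variables with coefficient 3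
  contribute \<open>3q\<close> with \<open>0 \<le> q \<le> k\<close>, and \<open>n - 3q\<close> has to be a sum of two of these four values.
  Modulo 3 this excludes \<open>3m - 10\<close> (if \<open>3\<close> divides \<open>m\<close>) and \<open>3m - 12\<close> (if \<open>m \<equiv> 1\<close>) for
  \<open>k = m - 5\<close>, and \<open>2m - 9\<close> (if \<open>m \<equiv> 2\<close>) for \<open>3k = 2m - 13\<close>. In the last case
  \<open>2m - 10 = P\<^sub>m(-1) + P\<^sub>m(1) + (m - 8)\<close> is represented although it exceeds \<open>3k + 2\<close>.
\<close>

text \<open>A universality bound below \<open>N\<close> would see only represented numbers and so
  certify the form as universal. The missed number \<open>n0\<close> need not equal
  \<open>N\<close>; for 3 | m it lies above it.\<close>

lemma gamma_ge:
  assumes "coeff_tuple a" "\<And>n. 1 \<le> n \<Longrightarrow> n < N \<Longrightarrow> represents m a n"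
    and "1 \<le> n0" "\<not> represents m a n0"
  shows "enat N \<le> gamma m"
  unfolding gamma_def
proof (rule INF_greatest)
  fix g assume "g \<in> {g. universality_bound m g}"
  then have g: "universality_bound m g"
    by simp
  have "N \<le> g"
  proof (rule ccontr)
    assume "\<not> N \<le> g"
    then have "universal m a"
      using g assms(1,2) unfolding universality_bound_def by auto
    then show False
      using assms(3,4) unfolding universal_def by blast
  qed
  then show "enat N \<le> enat g"
    by simp
qed

lemma polygonal_0 [simp]: "polygonal m 0 = 0"
  by (simp add: polygonal_def)

lemma polygonal_1 [simp]: "polygonal m 1 = 1"
  by (simp add: polygonal_def)

lemma polygonal_minus_1 [simp]: "polygonal m (- 1) = int m - 3"
  using two_times_polygonal[of m "- 1"] by simp

lemma polygonal_2 [simp]: "polygonal m 2 = int m"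
  using two_times_polygonal[of m 2] by simp

text \<open>Twice the value is \<open>(m - 2) * x * (x - 1) + 2 * x\<close>, which settles x \<ge>
  3, and also \<open>(m - 4) * x * (x - 1) + 2 * x^2\<close>, whose terms stay nonnegative for x
  \<le> -2. The constant \<open>3 * m - 8\<close> is attained at x = -2.\<close>

lemma polygonal_values:
  assumes "m \<ge> 4"
  shows "polygonal m x \<in> {0, 1, int m - 3, int m} \<or> polygonal m x \<ge> 3 * int m - 8"
proof -
  consider "x \<in> {0, 1, - 1, 2}" | "x \<ge> 3" | "x \<le> - 2"
    by force
  then show ?thesis
  proof cases
    case 1
    then show ?thesis by auto
  next
    case 2
    have "(int m - 2) * (x * (x - 1)) \<ge> (int m - 2) * (3 * 2)"
      using assms 2 by (intro mult_left_mono mult_mono) auto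
    then have "2 * polygonal m x \<ge> 6 * int m - 12 + 2 * x"
      using two_times_polygonal[of m x] by (simp add: power2_eq_square algebra_simps)
    then have "polygonal m x \<ge> 3 * int m - 8"
      using 2 by linarith
    then show ?thesis ..
  next
    case 3
    have "(int m - 4) * ((- x) * (1 - x)) \<ge> (int m - 4) * (2 * 3)"
      using assms 3 by (intro mult_left_mono mult_mono) auto
    moreover have "(- x) * (- x) \<ge> 2 * 2"
      using 3 by (intro mult_mono) auto
    ultimately have "2 * polygonal m x \<ge> 6 * int m - 16"
      using two_times_polygonal[of m x] by (simp add: power2_eq_square algebra_simps)
    then have "polygonal m x \<ge> 3 * int m - 8"
      by linarith
    then show ?thesis ..
  qed
qed

lemma polygonal_nonneg: "m \<ge> 4 \<Longrightarrow> polygonal m x \<ge> 0"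
  using polygonal_values[of m x] by auto

lemma coeff_tuple_ones_threes: "coeff_tuple (1 # 1 # replicate k 3)"
  by (auto simp: coeff_tuple_def)

lemma polygonal_form_ones_threes:
  "polygonal_form m (1 # 1 # replicate k 3) (x # y # z) =
    polygonal m x + polygonal m y + 3 * (\<Sum>j<k. polygonal m (z ! j))"
  by (simp add: polygonal_form_def sum.lessThan_Suc_shift sum_distrib_left
      del: sum.lessThan_Suc)

lemma represents_ones_threesI:
  assumes "t \<le> k" "int n = polygonal m x + polygonal m y + 3 * int t"
  shows "represents m (1 # 1 # replicate k 3) n"
  unfolding represents_def
proof (intro exI conjI)
  let ?z = "map (\<lambda>j. if j < t then 1 else 0) [0..<k]"
  have "(\<Sum>j<k. polygonal m (?z ! j)) = (\<Sum>j<k. if j < t then 1 else 0)"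
    by (intro sum.cong) auto
  also have "\<dots> = (\<Sum>j<t. 1)"
    using assms(1) by (intro sum.mono_neutral_cong_right) auto
  finally have "(\<Sum>j<k. polygonal m (?z ! j)) = int t"
    by simp
  then show "polygonal_form m (1 # 1 # replicate k 3) (x # y # ?z) = int n"
    using assms(2) by (simp only: polygonal_form_ones_threes)
qed simp

lemma represents_ones_threes_initial:
  assumes "n \<le> 3 * k + 2"
  shows "represents m (1 # 1 # replicate k 3) n"
proof -
  consider "n = 3 * (n div 3)" "n div 3 \<le> k" | "n = 3 * (n div 3) + 1" "n div 3 \<le> k"
    | "n = 3 * (n div 3) + 2" "n div 3 \<le> k"
    using assms by linarith
  then show ?thesis
  proof cases
    case 1
    then show ?thesis
      by (intro represents_ones_threesI[of "n div 3" _ _ _ 0 0]) auto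
  next
    case 2
    then show ?thesis
      by (intro represents_ones_threesI[of "n div 3" _ _ _ 1 0]) auto
  next
    case 3
    then show ?thesis
      by (intro represents_ones_threesI[of "n div 3" _ _ _ 1 1]) auto
  qed
qed

lemma represents_ones_threesE:
  assumes "m \<ge> 4" "int n < 3 * int m - 9" "represents m (1 # 1 # replicate k 3) n"
  obtains p p' q where "p \<in> {0, 1, int m - 3, int m}" "p' \<in> {0, 1, int m - 3, int m}"
    "0 \<le> q" "q \<le> int k" "int n = p + p' + 3 * q"
proof -
  obtain xs where "length xs = Suc (Suc k)"
    and eq: "polygonal_form m (1 # 1 # replicate k 3) xs = int n"
    using assms(3) by (auto simp: represents_def)
  then obtain x y z where xs: "xs = x # y # z"
    by (auto simp: length_Suc_conv)
  define q where "q = (\<Sum>j<k. polygonal m (z ! j))"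
  have n: "int n = polygonal m x + polygonal m y + 3 * q"
    using eq unfolding xs q_def polygonal_form_ones_threes by simp
  have nonneg: "polygonal m w \<ge> 0" for w
    using assms(1) by (rule polygonal_nonneg)
  have q0: "q \<ge> 0"
    unfolding q_def by (intro sum_nonneg nonneg)
  \<comment> \<open>The hypothesis \<open>n < 3 * m - 9\<close> is chosen for this: under
    coefficient 3 there is no room even for the value \<open>m - 3\<close>, so only 0 and 1
    remain.\<close>
  have q_lt: "q < int m - 3"
    using n assms(2) nonneg[of x] nonneg[of y] by linarith
  have "polygonal m (z ! j) \<le> 1" if "j < k" for j
  proof -
    have "polygonal m (z ! j) \<le> q"
      unfolding q_def using that by (intro member_le_sum nonneg) auto
    then show ?thesis
      using q_lt polygonal_values[OF assms(1), of "z ! j"] assms(1) by auto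
  qed
  then have "q \<le> int k"
    unfolding q_def using sum_bounded_above[of "{..<k}" "\<lambda>j. polygonal m (z ! j)" 1] by simp
  moreover have "polygonal m x \<in> {0, 1, int m - 3, int m}"
    using polygonal_values[OF assms(1), of x] n assms(2) nonneg[of y] q0 by linarith
  moreover have "polygonal m y \<in> {0, 1, int m - 3, int m}"
    using polygonal_values[OF assms(1), of y] n assms(2) nonneg[of x] q0 by linarith
  ultimately show ?thesis
    using that q0 n by blast
qed

text \<open>Modulo 3 the four values are 0, 1, 0, 0 and the target is 2. Hence p = p' = 1, which
  forces q = M - 4.\<close>

lemma two_values_mod_3_excluded_0:
  fixes M l p p' q :: int
  assumes "p \<in> {0, 1, M - 3, M}" "p' \<in> {0, 1, M - 3, M}" "0 \<le> q" "q \<le> M - 5"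
    and "3 * M - 10 = p + p' + 3 * q" "M \<ge> 14" "M = 3 * l"
  shows False
  using assms by (elim insertE emptyE) (simp_all, presburger+)

text \<open>Modulo 3 the four values are 0, 1, 1, 1 and the target is 0. Hence p = p' = 0, which
  again forces q = M - 4.\<close>

lemma two_values_mod_3_excluded_1:
  fixes M l p p' q :: int
  assumes "p \<in> {0, 1, M - 3, M}" "p' \<in> {0, 1, M - 3, M}" "0 \<le> q" "q \<le> M - 5"
    and "3 * M - 12 = p + p' + 3 * q" "M \<ge> 14" "M = 3 * l + 1"
  shows False
  using assms by (elim insertE emptyE) (simp_all, presburger+)

text \<open>Modulo 3 the four values are 0, 1, 2, 2 and the target is 1. Either {p, p'} = {0, 1}, so
  3q = 2M - 10 is too large, or both are at least M - 3 and their sum already exceeds the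
  target.\<close>

lemma two_values_mod_3_excluded_2:
  fixes M l p p' q :: int
  assumes "p \<in> {0, 1, M - 3, M}" "p' \<in> {0, 1, M - 3, M}" "0 \<le> q" "3 * q \<le> 2 * M - 13"
    and "2 * M - 9 = p + p' + 3 * q" "M \<ge> 14" "M = 3 * l + 2"
  shows False
  using assms by (elim insertE emptyE) (simp_all, presburger+)

theorem corollary1p2:
  fixes m :: nat
  assumes "m \<ge> 14"
  shows "gamma m \<ge> (if [m \<noteq> 2] (mod 3) then enat (3 * m - 12) else enat (2 * m - 9))"
proof -
  have m4: "m \<ge> 4"
    using assms by simp
  have "(\<exists>l. m = 3 * l) \<or> (\<exists>l. m = 3 * l + 1) \<or> (\<exists>l. m = 3 * l + 2)"
    by presburger
  then consider l where "m = 3 * l" | l where "m = 3 * l + 1" | l where "m = 3 * l + 2"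
    by blast
  then show ?thesis
  proof cases
    case 1
    \<comment> \<open>With k = m - 5 the initial segment ends at 3k + 2 = 3m - 13, just below the
      claimed bound.\<close>
    let ?a = "1 # 1 # replicate (m - 5) 3"
    have "\<not> represents m ?a (3 * m - 10)"
    proof
      assume r: "represents m ?a (3 * m - 10)"
      have "int (3 * m - 10) < 3 * int m - 9"
        using assms by simp
      from represents_ones_threesE[OF m4 this r] obtain p p' q
        where "p \<in> {0, 1, int m - 3, int m}" "p' \<in> {0, 1, int m - 3, int m}"
          and "0 \<le> q" "q \<le> int (m - 5)" "int (3 * m - 10) = p + p' + 3 * q" .
      then show False
        using 1 assms by (intro two_values_mod_3_excluded_0[of p "int m" p' q "int l"]) auto
    qed
    then have "enat (3 * m - 12) \<le> gamma m"
      using assms by (intro gamma_ge[OF coeff_tuple_ones_threes]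
          represents_ones_threes_initial) auto
    then show ?thesis
      using 1 by (simp add: cong_def)
  next
    case 2
    let ?a = "1 # 1 # replicate (m - 5) 3"
    have "\<not> represents m ?a (3 * m - 12)"
    proof
      assume r: "represents m ?a (3 * m - 12)"
      have "int (3 * m - 12) < 3 * int m - 9"
        using assms by simp
      from represents_ones_threesE[OF m4 this r] obtain p p' q
        where "p \<in> {0, 1, int m - 3, int m}" "p' \<in> {0, 1, int m - 3, int m}"
          and "0 \<le> q" "q \<le> int (m - 5)" "int (3 * m - 12) = p + p' + 3 * q" .
      then show False
        using 2 assms by (intro two_values_mod_3_excluded_1[of p "int m" p' q "int l"]) auto
    qed
    then have "enat (3 * m - 12) \<le> gamma m"
      using assms by (intro gamma_ge[OF coeff_tuple_ones_threes]
          represents_ones_threes_initial) auto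
    then show ?thesis
      using 2 by (simp add: cong_def)
  next
    case 3
    \<comment> \<open>This is the largest k that keeps 2m - 9 = 0 + 1 + 3(2l - 2) out of reach. The
      initial segment then ends at 3k + 2 = 2m - 11, so 2m - 10 needs its own
      representation.\<close>
    define k where "k = 2 * l - 3"
    have k: "3 * k + 13 = 2 * m"
      using 3 assms unfolding k_def by simp
    let ?a = "1 # 1 # replicate k 3"
    have "represents m ?a (2 * m - 10)"
      using 3 assms by (intro represents_ones_threesI[of "l - 2" _ _ _ "- 1" 1]) (auto simp: k_def)
    then have "represents m ?a n" if "n < 2 * m - 9" for n
      using that k represents_ones_threes_initial[of n k m]
      by (cases "n = 2 * m - 10") auto
    moreover have "\<not> represents m ?a (2 * m - 9)"
    proof
      assume r: "represents m ?a (2 * m - 9)"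
      have "int (2 * m - 9) < 3 * int m - 9"
        using assms by simp
      from represents_ones_threesE[OF m4 this r] obtain p p' q
        where "p \<in> {0, 1, int m - 3, int m}" "p' \<in> {0, 1, int m - 3, int m}"
          and "0 \<le> q" "q \<le> int k" "int (2 * m - 9) = p + p' + 3 * q" .
      then show False
        using 3 assms k by (intro two_values_mod_3_excluded_2[of p "int m" p' q "int l"]) auto
    qed
    ultimately have "enat (2 * m - 9) \<le> gamma m"
      using assms by (intro gamma_ge[OF coeff_tuple_ones_threes]) auto
    moreover have "[m = 2] (mod 3)"
      unfolding 3 cong_def by presburger
    ultimately show ?thesis
      by simp
  qed
qed

end
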